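(* Let $G$ be a connected graph of order $n\ge 2$ and let $H$ be an arbitrary graph of order at least $2$. Suppose that (i) for each adjacency basis of $H$ there exists a vertex of $H$ with adjacency representation entirely $1$ with respect to it, and (ii) there exists an adjacency basis $W$ of $H$ such that no vertex of $H$ has adjacency representation entirely $2$ with respect to $W$. Then $\beta(G[H])=n\,\beta_2(H)+a(G)-\iota_{K}(G)$.
   Context: All graphs are finite and simple; $u\sim v$ means that $u,v$ are adjacent. For a connected graph $X$, an ordered set $W=\{w_1,\dots,w_k\}\subseteq V(X)$ is a resolving set if the vectors $(d_X(v,w_1),\dots,d_X(v,w_k))$, $v\in V(X)$, are pairwise distinct ($d_X$ is the graph distance); the metric dimension $\beta(X)$ is the minimum cardinality of a resolving set of $X$. For any graph $H$ and vertices $v,w$, set $a_H(v,w)=0$ if $v=w$, $a_H(v,w)=1$ if $v\sim w$, and $a_H(v,w)=2$ if $v\ne w$ and $v\nsim w$. For an ordered set $W=\{w_1,\dots,w_k\}\subseteq V(H)$ the adjacency representation of $v$ with respect to $W$ is $r_2(v|W)=(a_H(v,w_1),\dots,a_H(v,w_k))$; it is entirely $i$ if all its entries equal $i$. $W$ is an adjacency resolving set of $H$ if distinct vertices of $H$ have distinct adjacency representations with respect to $W$; the adjacency metric dimension $\beta_2(H)$ is the minimum cardinality of an adjacency resolving set, and an adjacency basis of $H$ is an adjacency resolving set of cardinality $\beta_2(H)$. The lexicographic product $G[H]$ has vertex set $V(G)\times V(H)$, with $(v,u)$ and $(v',u')$ adjacent iff $v\sim v'$ in $G$, or $v=v'$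 and $u\sim u'$ in $H$. Two distinct vertices $u,v$ of $G$ are twins if $N(v)\setminus\{u\}=N(u)\setminus\{v\}$, where $N(x)$ is the set of neighbors of $x$; the relation $u\equiv v$ iff $u=v$ or $u,v$ are twins is an equivalence relation on $V(G)$, each of whose classes is a clique or an independent set. A class is of type (K) if it is a clique of size at least $2$. $\iota_K(G)$ is the number of classes of type (K), and $a(G)$ is the total number of vertices lying in classes of type (K) (equivalently, the number of vertices having an adjacent twin). *)

theory Defs
  imports "Graph_Theory.Graph_Theory" "HOL-Library.FuncSet"
begin

text \<open>
  Finite simple graphs are values \<open>G :: 'a pair_pre_digraph\<close> satisfying the locale predicate
  \<^const>\<open>pair_graph\<close>: finite vertex set, no loops, and a symmetric set of ordered pairs as arcs, so
  that \<open>u \<rightarrow>\<^bsub>G\<^esub> v\<close> is adjacency.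
\<close>


section \<open>Metric dimension\<close>

text \<open>
  The graph distance is the library's shortest-path cost for unit arc weights.

  The vector of a vertex with respect to an ordered set \<open>W\<close> is rendered as the function on \<open>W\<close>
  giving its entries (extended by \<^const>\<open>undefined\<close>); two such vectors agree for one
  ordering of \<open>W\<close> iff they agree for every ordering, so \<open>W\<close> itself is a plain set.
\<close>

definition gdist :: "'a pair_pre_digraph \<Rightarrow> 'a \<Rightarrow> 'a \<Rightarrow> ereal" where
  "gdist X u v = wf_digraph.\<mu> X (\<lambda>_. 1) u v"

definition metric_rep :: "'a pair_pre_digraph \<Rightarrow> 'a set \<Rightarrow> 'a \<Rightarrow> 'a \<Rightarrow> ereal" where
  "metric_rep X W v = (\<lambda>w\<in>W. gdist X v w)"

definition resolving_set :: "'a pair_pre_digraph \<Rightarrow> 'a set \<Rightarrow> bool" where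
  "resolving_set X W \<longleftrightarrow> W \<subseteq> pverts X \<and> inj_on (metric_rep X W) (pverts X)"

definition metric_dim :: "'a pair_pre_digraph \<Rightarrow> nat" where
  "metric_dim X = (LEAST k. \<exists>W. resolving_set X W \<and> card W = k)"


section \<open>Adjacency metric dimension\<close>

definition adj_dist :: "'a pair_pre_digraph \<Rightarrow> 'a \<Rightarrow> 'a \<Rightarrow> nat" where
  "adj_dist H v w = (if v = w then 0 else if v \<rightarrow>\<^bsub>H\<^esub> w then 1 else 2)"

definition adj_rep :: "'a pair_pre_digraph \<Rightarrow> 'a set \<Rightarrow> 'a \<Rightarrow> 'a \<Rightarrow> nat" where
  "adj_rep H W v = (\<lambda>w\<in>W. adj_dist H v w)"

definition entirely :: "nat \<Rightarrow> 'a pair_pre_digraph \<Rightarrow> 'a set \<Rightarrow> 'a \<Rightarrow> bool" where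
  "entirely i H W v \<longleftrightarrow> (\<forall>w\<in>W. adj_rep H W v w = i)"

definition adj_resolving_set :: "'a pair_pre_digraph \<Rightarrow> 'a set \<Rightarrow> bool" where
  "adj_resolving_set H W \<longleftrightarrow> W \<subseteq> pverts H \<and> inj_on (adj_rep H W) (pverts H)"

definition adj_metric_dim :: "'a pair_pre_digraph \<Rightarrow> nat" where
  "adj_metric_dim H = (LEAST k. \<exists>W. adj_resolving_set H W \<and> card W = k)"

definition adj_basis :: "'a pair_pre_digraph \<Rightarrow> 'a set \<Rightarrow> bool" where
  "adj_basis H W \<longleftrightarrow> adj_resolving_set H W \<and> card W = adj_metric_dim H"


section \<open>Lexicographic product\<close>

definition lexicographic_product :: "'a pair_pre_digraph \<Rightarrow> 'b pair_pre_digraph \<Rightarrow> ('a \<times> 'b) pair_pre_digraph" where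
  "lexicographic_product G H = \<lparr> pverts = pverts G \<times> pverts H,
     parcs = {((v, u), (v', u')) | v u v' u'.
       v \<in> pverts G \<and> v' \<in> pverts G \<and> u \<in> pverts H \<and> u' \<in> pverts H \<and>
       (v \<rightarrow>\<^bsub>G\<^esub> v' \<or> v = v' \<and> u \<rightarrow>\<^bsub>H\<^esub> u')} \<rparr>"

lemma pair_graph_lexicographic_product:
  assumes "pair_graph G" "pair_graph H"
  shows "pair_graph (lexicographic_product G H)"
proof -
  interpret G: pair_graph G by fact
  interpret H: pair_graph H by fact
  have fin: "finite (parcs (lexicographic_product G H))"
    by (rule finite_subset[of _ "(pverts G \<times> pverts H) \<times> (pverts G \<times> pverts H)"])
       (auto simp: lexicographic_product_def)
  show ?thesis
    using fin G.arcs_symmetric H.arcs_symmetric G.no_loops' H.no_loops'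
    by unfold_locales (auto simp: lexicographic_product_def symmetric_def intro!: symI)
qed


section \<open>Twins\<close>

definition nbhd :: "'a pair_pre_digraph \<Rightarrow> 'a \<Rightarrow> 'a set" where
  "nbhd G x = {y. x \<rightarrow>\<^bsub>G\<^esub> y}"

definition twins :: "'a pair_pre_digraph \<Rightarrow> 'a \<Rightarrow> 'a \<Rightarrow> bool" where
  "twins G u v \<longleftrightarrow> u \<noteq> v \<and> nbhd G v - {u} = nbhd G u - {v}"

definition twin_rel :: "'a pair_pre_digraph \<Rightarrow> 'a rel" where
  "twin_rel G = {(u, v). u \<in> pverts G \<and> v \<in> pverts G \<and> (u = v \<or> twins G u v)}"

definition clique :: "'a pair_pre_digraph \<Rightarrow> 'a set \<Rightarrow> bool" where
  "clique G C \<longleftrightarrow> C \<subseteq> pverts G \<and> (\<forall>u\<in>C. \<forall>v\<in>C. u \<noteq> v \<longrightarrow> u \<rightarrow>\<^bsub>G\<^esub> v)"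

definition K_classes :: "'a pair_pre_digraph \<Rightarrow> 'a set set" where
  "K_classes G = {C \<in> pverts G // twin_rel G. clique G C \<and> 2 \<le> card C}"

definition iota_K :: "'a pair_pre_digraph \<Rightarrow> nat" where
  "iota_K G = card (K_classes G)"

definition num_K_verts :: "'a pair_pre_digraph \<Rightarrow> nat" where
  "num_K_verts G = card (\<Union>(K_classes G))"

lemma equiv_twin_rel:
  assumes "pair_graph G"
  shows "equiv (pverts G) (twin_rel G)"
proof -
  interpret G: pair_graph G by fact
  have sym: "(a, b) \<in> parcs G \<longleftrightarrow> (b, a) \<in> parcs G" for a b
    using G.arcs_symmetric by blast
  have "trans (twin_rel G)"
  proof (rule transI)
    fix x y z assume "(x, y) \<in> twin_rel G" "(y, z) \<in> twin_rel G"
    moreover have "twins G x z" if "twins G x y" "twins G y z" "x \<noteq> z"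
    proof -
      have 1: "(x, a) \<in> parcs G \<longleftrightarrow> (y, a) \<in> parcs G" if "a \<noteq> x" "a \<noteq> y" for a
        using \<open>twins G x y\<close> that by (auto simp: twins_def nbhd_def set_eq_iff)
      have 2: "(y, a) \<in> parcs G \<longleftrightarrow> (z, a) \<in> parcs G" if "a \<noteq> y" "a \<noteq> z" for a
        using \<open>twins G y z\<close> that by (auto simp: twins_def nbhd_def set_eq_iff)
      have "x \<noteq> y" "y \<noteq> z" using that by (auto simp: twins_def)
      then have 3: "(x, a) \<in> parcs G \<longleftrightarrow> (z, a) \<in> parcs G" if "a \<noteq> x" "a \<noteq> z" for a
        using 1 2 sym that \<open>x \<noteq> z\<close> by metis
      have nl: "(a, a) \<notin> parcs G" for a
        using G.no_loops' by blast
      show ?thesis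
        using \<open>x \<noteq> z\<close> 3 nl unfolding twins_def nbhd_def set_eq_iff
        by (metis Diff_iff mem_Collect_eq singletonD singletonI with_proj_simps(3))
    qed
    ultimately show "(x, z) \<in> twin_rel G"
      by (auto simp: twin_rel_def)
  qed
  then show ?thesis
    by (auto simp: equiv_def refl_on_def sym_def twin_rel_def twins_def)
qed

end

theory Submission
  imports Defs
begin

text \<open>
  Cut a vertex set \<open>W\<close> of \<open>G[H]\<close> into its fibres \<open>W\<^sub>v = {u. (v, u) \<in> W}\<close>. Two vertices in the same
  copy of \<open>H\<close> are at distance at most \<open>2\<close>, since every vertex of \<open>G\<close> has a neighbour, and no vertex of
  another copy tells them apart; so \<open>W\<close> separates all such pairs iff every fibre is adjacency resolving in
  \<open>H\<close>. Fibres are then non-empty, because \<open>H\<close> has two vertices.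
  Vertices \<open>(v, u)\<close> and \<open>(v', u')\<close> of different copies are separated by a third copy unless \<open>v\<close>
  and \<open>v'\<close> have equal distances to all other vertices of \<open>G\<close>, that is, unless they are twins. Twins
  are at distance \<open>d = 1\<close> or \<open>d = 2\<close>, and then the pair remains unseparated exactly when \<open>u\<close> is
  entirely \<open>d\<close> on the fibre over \<open>v\<close> and \<open>u'\<close> is entirely \<open>d\<close> on the fibre over \<open>v'\<close>. This is the theorem
  \<open>resolving_set_iff_fibres\<close>; the rest is counting over the fibres.

  For the lower bound, \<open>card_resolving_set_ge\<close>: every fibre has at least \<open>\<beta>\<^sub>2(H)\<close> elements. Each
  adjacency basis admits an entirely \<open>1\<close> vertex and two distinct vertices in a common class of type (K)
  are adjacent twins, so in such a class at most one fibre can be a basis. All other vertices of the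
  class cost one more element each, which totals at least \<open>a(G) - \<iota>\<^sub>K(G)\<close>.

  For the upper bound, \<open>resolving_set_from_basis\<close>: take a basis \<open>B\<close> with no entirely \<open>2\<close> vertex,
  and let \<open>u\<close> be its entirely \<open>1\<close> vertex. Because \<open>B\<close> is resolving, \<open>u\<close> is the only such vertex, so
  \<open>B \<union> {u}\<close> has none. Use \<open>B\<close> as the fibre everywhere, except that in each class of type (K) all
  vertices but one representative receive \<open>B \<union> {u}\<close>.
\<close>

section \<open>Graph distance\<close>

lemma gdist_walks:
  assumes "pair_wf_digraph X"
  shows "gdist X u v = (INF p\<in>{p. pre_digraph.awalk X u p v}. ereal (length p))"
proof -
  interpret pair_wf_digraph X by fact
  show ?thesis
    by (simp add: gdist_def \<mu>_def awalk_cost_def sum_list_triv)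
qed

lemma gdist_le_length:
  assumes "pair_wf_digraph X" and "pre_digraph.awalk X u p v"
  shows "gdist X u v \<le> ereal (length p)"
  using assms by (auto simp: gdist_walks intro!: INF_lower)

text \<open>
  A shortest walk is mapped step by step, dropping the steps that \<open>f\<close> contracts. Allowing
  contractions makes the lemma apply to the projection \<open>G[H] \<rightarrow> G\<close> as well as to the sections
  \<open>G \<rightarrow> G[H]\<close> and to automorphisms of \<open>G\<close>.
\<close>

lemma gdist_nonexpansive:
  assumes X: "pair_wf_digraph X" and Y: "pair_wf_digraph Y"
    and verts: "\<And>a. a \<in> pverts X \<Longrightarrow> f a \<in> pverts Y"
    and arcs: "\<And>a b. (a, b) \<in> parcs X \<Longrightarrow> f a = f b \<or> (f a, f b) \<in> parcs Y"
  shows "gdist Y (f u) (f v) \<le> gdist X u v"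
proof -
  interpret X: pair_wf_digraph X by fact
  interpret Y: pair_wf_digraph Y by fact
  have "\<exists>q. Y.awalk (f u) q (f v) \<and> length q \<le> length p" if "X.awalk u p v" for p
    using that
  proof (induction p arbitrary: u)
    case Nil
    then show ?case
      using verts by (auto simp: X.awalk_Nil_iff Y.awalk_Nil_iff intro!: exI[of _ "[]"])
  next
    case (Cons e p)
    obtain a b where [simp]: "e = (a, b)" by (cases e)
    from Cons.prems have e: "(a, b) \<in> parcs X" "u = a" "X.awalk b p v"
      by (auto simp: X.awalk_Cons_iff)
    from Cons.IH[OF e(3)] obtain q where q: "Y.awalk (f b) q (f v)" "length q \<le> length p"
      by blast
    show ?case
    proof (cases "f a = f b")
      case True
      then show ?thesis using q e by (intro exI[of _ q]) auto
    next
      case False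
      then show ?thesis
        using q e arcs[OF e(1)]
        by (intro exI[of _ "(f a, f b) # q"]) (auto simp: Y.awalk_Cons_iff)
    qed
  qed
  then have "gdist Y (f u) (f v) \<le> ereal (length p)" if "X.awalk u p v" for p
    using that gdist_le_length[OF Y] by (meson ereal_less_eq(3) of_nat_mono order_trans)
  then show ?thesis
    by (auto simp: gdist_walks[OF X] intro!: INF_greatest)
qed

lemma adj_dist_le_gdist:
  assumes "pair_wf_digraph X"
  shows "ereal (adj_dist X u v) \<le> gdist X u v"
proof -
  interpret pair_wf_digraph X by fact
  have "adj_dist X u v \<le> length p" if "awalk u p v" for p
  proof (cases p)
    case Nil
    then show ?thesis using that by (simp add: awalk_Nil_iff adj_dist_def)
  next
    case (Cons e q)
    then show ?thesis
      using that by (cases q; cases e) (auto simp: awalk_Cons_iff awalk_Nil_iff adj_dist_def)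
  qed
  then show ?thesis
    by (auto simp: gdist_walks[OF assms] intro!: INF_greatest)
qed

lemma gdist_adjacent:
  assumes "pair_wf_digraph X" and "(u, v) \<in> parcs X" and "u \<noteq> v"
  shows "gdist X u v = 1"
proof (rule antisym)
  interpret pair_wf_digraph X by fact
  have "awalk u [(u, v)] v"
    using assms(2) in_arcsD2 by (auto simp: awalk_Cons_iff awalk_Nil_iff)
  then show "gdist X u v \<le> 1"
    using gdist_le_length[OF assms(1)] by (metis (no_types) length_Cons list.size(3) of_nat_1 One_nat_def one_ereal_def)
  show "1 \<le> gdist X u v"
    using adj_dist_le_gdist[OF assms(1), of u v] assms(2,3)
    by (simp add: adj_dist_def one_ereal_def)
qed

text \<open>
  With a common neighbour the distance is at most \<open>2\<close>, and up to \<open>2\<close> the distance and the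
  adjacency entry carry the same information. Allowing \<open>u = v\<close>
  gives one formula for all pairs inside a copy of \<open>H\<close>.
\<close>

lemma gdist_common_neighbour:
  assumes X: "pair_graph X" and arcs: "(u, z) \<in> parcs X" "(z, v) \<in> parcs X"
  shows "gdist X u v = ereal (adj_dist X u v)"
proof (rule antisym)
  interpret pair_graph X by fact
  have wf: "pair_wf_digraph X" ..
  show "ereal (adj_dist X u v) \<le> gdist X u v"
    by (rule adj_dist_le_gdist[OF wf])
  have "\<exists>p. awalk u p v \<and> length p \<le> adj_dist X u v"
  proof -
    consider "u = v" | "u \<noteq> v" "(u, v) \<in> parcs X" | "u \<noteq> v" "(u, v) \<notin> parcs X" by blast
    then show ?thesis
    proof cases
      case 1
      then show ?thesis using in_arcsD1[OF arcs(1)] by (intro exI[of _ "[]"]) (auto simp: awalk_Nil_iff)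
    next
      case 2
      then show ?thesis using in_arcsD2
        by (intro exI[of _ "[(u, v)]"]) (auto simp: awalk_simps adj_dist_def)
    next
      case 3
      then show ?thesis using arcs in_arcsD2
        by (intro exI[of _ "[(u, z), (z, v)]"]) (auto simp: awalk_simps adj_dist_def)
    qed
  qed
  then show "gdist X u v \<le> ereal (adj_dist X u v)"
    using gdist_le_length[OF wf] by (meson ereal_less_eq(3) of_nat_mono order_trans)
qed

lemma pair_graph_sym:
  assumes "pair_graph X" shows "(u, v) \<in> parcs X \<longleftrightarrow> (v, u) \<in> parcs X"
proof -
  interpret pair_graph X by fact
  show ?thesis using arcs_symmetric by blast
qed

lemma pair_graph_irrefl:
  assumes "pair_graph X" shows "(u, u) \<notin> parcs X"
proof -
  interpret pair_graph X by fact
  show ?thesis using no_loops' by blast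
qed

lemma connected_has_neighbour:
  assumes "pair_graph X" and "connected X" and "card (pverts X) \<ge> 2" and "v \<in> pverts X"
  obtains z where "z \<in> pverts X" "(v, z) \<in> parcs X"
proof -
  interpret pair_graph X by fact
  obtain u where u: "u \<in> pverts X" "u \<noteq> v"
    using assms(3) by (metis card_le_Suc0_iff_eq not_less_eq_eq numeral_2_eq_2 pair_finite_verts assms(4))
  have "v \<rightarrow>\<^sup>*\<^bsub>mk_symmetric X\<^esub> u"
    using assms(2,4) u by (auto simp: connected_def strongly_connected_def)
  then have "v \<rightarrow>\<^sup>*\<^bsub>X\<^esub> u"
    using reachable_mk_symmetric_eq graph_symmetric by blast
  then show thesis
    using u(2) in_arcsD2 that
    by (cases rule: converse_reachable_cases) auto
qed

section \<open>Twins\<close>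

lemma twinsD:
  "twins X u v \<Longrightarrow> x \<noteq> u \<Longrightarrow> x \<noteq> v \<Longrightarrow> (u, x) \<in> parcs X \<longleftrightarrow> (v, x) \<in> parcs X"
  by (auto simp: twins_def nbhd_def)

lemma twins_sym: "twins X u v \<Longrightarrow> twins X v u"
  by (auto simp: twins_def)

text \<open>
  Exchanging two twins is an automorphism that fixes every other vertex, which gives equality of
  distances; conversely, neighbourhoods are read off from the distances equal to \<open>1\<close>.
\<close>

lemma twins_iff_gdist:
  assumes X: "pair_graph X" and uv: "u \<in> pverts X" "v \<in> pverts X" "u \<noteq> v"
  shows "twins X u v \<longleftrightarrow> (\<forall>x\<in>pverts X - {u, v}. gdist X u x = gdist X v x)"
proof
  interpret pair_graph X by fact
  have wf: "pair_wf_digraph X" ..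
  have nl: "(a, a) \<notin> parcs X" for a using no_loops' by blast
  note sym = pair_graph_sym[OF X]
  {
    assume tw: "twins X u v"
    \<comment> \<open>\<open>?t\<close> is an involution, so non-expansiveness in one direction gives both inequalities.\<close>
    let ?t = "Transposition.transpose u v"
    have arcs: "(?t a, ?t b) \<in> parcs X" if "(a, b) \<in> parcs X" for a b
      using that twinsD[OF tw] sym nl uv(3) unfolding transpose_def by (smt (verit))
    have le: "gdist X (?t a) (?t b) \<le> gdist X a b" for a b
      using uv arcs by (intro gdist_nonexpansive[OF wf wf]) (auto simp: transpose_def)
    show "\<forall>x\<in>pverts X - {u, v}. gdist X u x = gdist X v x"
    proof
      fix x assume "x \<in> pverts X - {u, v}"
      then have "?t x = x" "?t u = v" "?t v = u" by auto
      then show "gdist X u x = gdist X v x"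
        using le[of u x] le[of v x] by simp
    qed
  next
    assume eq: "\<forall>x\<in>pverts X - {u, v}. gdist X u x = gdist X v x"
    have nbr: "(a, x) \<in> parcs X \<longleftrightarrow> gdist X a x = 1" if "a \<noteq> x" for a x
    proof
      assume "gdist X a x = 1"
      then show "(a, x) \<in> parcs X"
        using adj_dist_le_gdist[OF wf, of a x] that
        by (auto simp: adj_dist_def one_ereal_def split: if_splits)
    qed (use gdist_adjacent[OF wf] that in blast)
    have "(u, x) \<in> parcs X \<longleftrightarrow> (v, x) \<in> parcs X" if "x \<noteq> u" "x \<noteq> v" for x
    proof (cases "x \<in> pverts X")
      case True
      then show ?thesis using nbr[of u x] nbr[of v x] eq that by auto
    qed (use in_arcsD2 in blast)
    then show "twins X u v"
      using uv(3) nl unfolding twins_def nbhd_def with_proj_simps set_eq_iff Diff_iff mem_Collect_eq singleton_iff by metis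
  }
qed

text \<open>
  Non-adjacent twins of a connected graph share all their neighbours, and there is at least one.
\<close>

lemma twins_gdist:
  assumes X: "pair_graph X" "connected X" "card (pverts X) \<ge> 2"
    and u: "u \<in> pverts X" and tw: "twins X u v"
  shows "gdist X u v = ereal (adj_dist X u v)"
proof (cases "(u, v) \<in> parcs X")
  case True
  interpret pair_graph X by fact
  have "pair_wf_digraph X" ..
  then show ?thesis
    using True tw gdist_adjacent[of X u v] by (auto simp: adj_dist_def twins_def one_ereal_def)
next
  case False
  obtain z where z: "(u, z) \<in> parcs X"
    using connected_has_neighbour[OF X u] by blast
  then have "z \<noteq> v" using False by blast
  then have "(z, v) \<in> parcs X"
    using twinsD[OF tw, of z] z pair_graph_sym[OF X(1)] by (metis \<open>z \<noteq> v\<close> pair_graph_irrefl[OF X(1)])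
  then show ?thesis by (rule gdist_common_neighbour[OF X(1) z])
qed

text \<open>
  One adjacent pair of twins forces the whole class to be a clique: adjacency is transported from
  \<open>u \<sim> v\<close> to any two members by replacing an endpoint with one of its twins.
\<close>

lemma adjacent_twins_in_K_class:
  assumes X: "pair_graph X" and uv: "u \<in> pverts X" "v \<in> pverts X"
    and tw: "twins X u v" and adj: "(u, v) \<in> parcs X"
  shows "twin_rel X `` {u} \<in> K_classes X"
proof -
  interpret pair_graph X by fact
  let ?C = "twin_rel X `` {u}"
  note sym = pair_graph_sym[OF X, THEN iffD1]
  have eqv: "equiv (pverts X) (twin_rel X)" by (rule equiv_twin_rel[OF X])
  have sub: "?C \<subseteq> pverts X" by (auto simp: twin_rel_def)
  have step: "(c, a) \<in> parcs X" if "twins X a b" "twins X c a" "c \<noteq> b" "(a, b) \<in> parcs X" for a b c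
  proof -
    have "a \<noteq> b" "c \<noteq> a" using that by (auto simp: twins_def)
    have "(c, b) \<in> parcs X"
      using twinsD[OF that(2), of b] that \<open>a \<noteq> b\<close> by blast
    then have "(b, c) \<in> parcs X" by (rule sym)
    then have "(a, c) \<in> parcs X"
      using twinsD[OF that(1), of c] that \<open>c \<noteq> a\<close> by blast
    then show ?thesis by (rule sym)
  qed
  have u_adj: "(u, c) \<in> parcs X" if "c \<in> ?C" "c \<noteq> u" for c
  proof (cases "c = v")
    case False
    have "twins X c u" using that by (auto simp: twin_rel_def twins_def)
    from step[OF tw this False adj] show ?thesis by (rule sym)
  qed (use adj in simp)
  have "(c, d) \<in> parcs X" if "c \<in> ?C" "d \<in> ?C" "c \<noteq> d" for c d
  proof (cases "c = u \<or> d = u")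
    case True
    then show ?thesis
      using u_adj[OF that(1)] u_adj[OF that(2)] sym[of u c] \<open>c \<noteq> d\<close> by auto
  next
    case False
    have "(d, u) \<in> twin_rel X" "(c, u) \<in> twin_rel X" "(d, c) \<in> twin_rel X"
      using that eqv equivE symD transD by (metis Image_singleton_iff)+
    then have "twins X c u" "twins X d c"
      using False that(3) by (auto simp: twin_rel_def)
    moreover have "(c, u) \<in> parcs X"
      using u_adj[OF that(1)] False sym by simp
    ultimately have "(d, c) \<in> parcs X"
      using step[of c u d] False by blast
    then show ?thesis by (rule sym)
  qed
  then have "clique X ?C" using sub by (auto simp: clique_def)
  moreover have "2 \<le> card ?C"
  proof -
    have "{u, v} \<subseteq> ?C" using uv tw by (auto simp: twin_rel_def)
    moreover have "finite ?C" using sub pair_finite_verts by (rule finite_subset)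
    moreover have "u \<noteq> v" using tw by (simp add: twins_def)
    ultimately show ?thesis by (metis card_2_iff card_mono)
  qed
  ultimately show ?thesis using uv by (auto simp: K_classes_def quotient_def)
qed

lemma K_class_adjacent_twins:
  assumes X: "pair_graph X" and C: "C \<in> K_classes X" "u \<in> C" "v \<in> C" "u \<noteq> v"
  shows "twins X u v" "(u, v) \<in> parcs X"
proof -
  have "(u, v) \<in> twin_rel X"
    using C quotient_eq_iff[OF equiv_twin_rel[OF X], of C C u v]
    by (auto simp: K_classes_def)
  then show "twins X u v" using C(4) by (auto simp: twin_rel_def)
  show "(u, v) \<in> parcs X" using C by (auto simp: K_classes_def clique_def)
qed

lemma K_classes_disjoint:
  assumes "pair_graph X" "C \<in> K_classes X" "D \<in> K_classes X" "v \<in> C" "v \<in> D"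
  shows "C = D"
  using assms quotient_disj[OF equiv_twin_rel[OF assms(1)], of C D] by (auto simp: K_classes_def)

lemma K_classes_subset: "\<Union>(K_classes X) \<subseteq> pverts X"
  by (auto simp: K_classes_def clique_def)

lemma finite_K_classes: "finite (pverts X) \<Longrightarrow> finite (K_classes X)"
  using K_classes_subset[of X] finite_UnionD finite_subset by metis

section \<open>Adjacency resolving sets\<close>

lemma entirely_iff: "entirely i H W u \<longleftrightarrow> (\<forall>w\<in>W. adj_dist H u w = i)"
  by (auto simp: entirely_def adj_rep_def)

lemma adj_rep_eq_iff:
  "adj_rep H W u = adj_rep H W v \<longleftrightarrow> (\<forall>w\<in>W. adj_dist H u w = adj_dist H v w)"
  by (force simp: adj_rep_def restrict_def fun_eq_iff)

lemma metric_rep_eq_iff: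
  "metric_rep X W u = metric_rep X W v \<longleftrightarrow> (\<forall>w\<in>W. gdist X u w = gdist X v w)"
  by (force simp: metric_rep_def restrict_def fun_eq_iff)

lemma adj_resolving_set_nonempty:
  assumes "adj_resolving_set H W" and "card (pverts H) \<ge> 2"
  shows "W \<noteq> {}"
proof
  assume "W = {}"
  then have "\<forall>u\<in>pverts H. \<forall>v\<in>pverts H. u = v"
    using assms(1) by (simp add: adj_resolving_set_def inj_on_def adj_rep_eq_iff)
  moreover have "finite (pverts H)"
    using assms(2) card.infinite by fastforce
  ultimately show False using assms(2) by (auto dest: card_le_Suc0_iff_eq)
qed

lemma adj_metric_dim_le: "adj_resolving_set H W \<Longrightarrow> adj_metric_dim H \<le> card W"
  unfolding adj_metric_dim_def by (rule Least_le) blast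

lemma adj_resolving_set_mono:
  assumes "adj_resolving_set H W" "W \<subseteq> W'" "W' \<subseteq> pverts H"
  shows "adj_resolving_set H W'"
  using assms unfolding adj_resolving_set_def inj_on_def adj_rep_eq_iff by blast

section \<open>Resolving sets of a lexicographic product\<close>

definition fibre :: "('a \<times> 'b) set \<Rightarrow> 'a \<Rightarrow> 'b set" where
  "fibre W v = {u. (v, u) \<in> W}"

lemma sum_indicator_card:
  "finite A \<Longrightarrow> B \<subseteq> A \<Longrightarrow> (\<Sum>x\<in>A. if x \<in> B then 1 else 0) = card B"
  by (simp add: Int_absorb1 flip: sum.inter_restrict)

lemma card_eq_sum_card_fibres:
  assumes "finite A" "finite B" "W \<subseteq> A \<times> B"
  shows "card W = (\<Sum>v\<in>A. card (fibre W v))"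
proof -
  have "W = Sigma A (fibre W)" using assms(3) by (auto simp: fibre_def)
  moreover have "finite (fibre W v)" for v
    using assms(2,3) by (auto intro: finite_subset[of _ B] simp: fibre_def)
  ultimately show ?thesis using assms(1) card_SigmaI[of A "fibre W"] by simp
qed

locale lexicographic_factors =
  fixes G :: "'a pair_pre_digraph" and H :: "'b pair_pre_digraph"
  assumes G: "pair_graph G" and connected_G: "connected G" and card_G: "card (pverts G) \<ge> 2"
    and H: "pair_graph H" and card_H: "card (pverts H) \<ge> 2"
begin

abbreviation P :: "('a \<times> 'b) pair_pre_digraph" where
  "P \<equiv> lexicographic_product G H"

lemma pverts_P: "pverts P = pverts G \<times> pverts H"
  by (simp add: lexicographic_product_def)

lemma parcs_P:
  "((v, u), (v', u')) \<in> parcs P \<longleftrightarrow> v \<in> pverts G \<and> v' \<in> pverts G \<and> u \<in> pverts H \<and> u' \<in> pverts H \<and>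
     ((v, v') \<in> parcs G \<or> v = v' \<and> (u, u') \<in> parcs H)"
  by (simp add: lexicographic_product_def)

lemma graph_axioms: "pair_wf_digraph G" "pair_graph P" "pair_wf_digraph P"
proof -
  interpret G: pair_graph G by (rule G)
  interpret H: pair_graph H by (rule H)
  show P: "pair_graph P" by (rule pair_graph_lexicographic_product[OF G H])
  interpret P: pair_graph P by (rule P)
  show "pair_wf_digraph G" ..
  show "pair_wf_digraph P" ..
qed

lemma finite_pverts: "finite (pverts G)" "finite (pverts H)"
proof -
  interpret G: pair_graph G by (rule G)
  interpret H: pair_graph H by (rule H)
  show "finite (pverts G)" "finite (pverts H)"
    by (fact G.pair_finite_verts H.pair_finite_verts)+
qed

lemma gdist_same_fibre:
  assumes "v \<in> pverts G" "u \<in> pverts H" "u' \<in> pverts H"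
  shows "gdist P (v, u) (v, u') = ereal (adj_dist H u u')"
proof -
  obtain z where z: "z \<in> pverts G" "(v, z) \<in> parcs G"
    using connected_has_neighbour[OF G connected_G card_G assms(1)] by blast
  interpret G: pair_graph G by (rule G)
  have "gdist P (v, u) (v, u') = ereal (adj_dist P (v, u) (v, u'))"
    using assms z pair_graph_sym[OF G]
    by (intro gdist_common_neighbour[OF graph_axioms(2), of _ "(z, u)"]) (auto simp: parcs_P)
  moreover have "(v, v) \<notin> parcs G" using G.no_loops' by blast
  ultimately show ?thesis using assms by (auto simp: adj_dist_def parcs_P)
qed

text \<open>
  Projecting to \<open>G\<close> does not increase distances; nor does lifting \<open>G\<close> along a section that passes
  through both given vertices.
\<close>

lemma gdist_distinct_fibres:
  assumes "u \<in> pverts H" "u' \<in> pverts H" "v \<noteq> v'"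
  shows "gdist P (v, u) (v', u') = gdist G v v'"
proof (rule antisym)
  interpret G: pair_graph G by (rule G)
  have "gdist G (fst (v, u)) (fst (v', u')) \<le> gdist P (v, u) (v', u')"
    by (rule gdist_nonexpansive[OF graph_axioms(3,1)]) (auto simp: pverts_P lexicographic_product_def)
  then show "gdist G v v' \<le> gdist P (v, u) (v', u')" by simp
  let ?s = "\<lambda>x. (x, if x = v then u else u')"
  have "gdist P (?s v) (?s v') \<le> gdist G v v'"
    using assms G.in_arcsD1 G.in_arcsD2
    by (intro gdist_nonexpansive[OF graph_axioms(1,3)]) (auto simp: pverts_P parcs_P)
  then show "gdist P (v, u) (v', u') \<le> gdist G v v'" using assms(3) by simp
qed

text \<open>
  For vertices in different copies, the fibres over third vertices \<open>x\<close> compare \<open>d(v, x)\<close> with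
  \<open>d(v', x)\<close>, while the fibres over \<open>v\<close> and \<open>v'\<close> compare adjacency entries in \<open>H\<close> with
  \<open>d(v, v')\<close>. For twins this distance is \<open>adj_dist G v v'\<close>, so that one condition covers both
  adjacent and non-adjacent twins.
\<close>

theorem resolving_set_iff_fibres:
  assumes W: "W \<subseteq> pverts G \<times> pverts H"
  shows "resolving_set P W \<longleftrightarrow>
    (\<forall>v\<in>pverts G. adj_resolving_set H (fibre W v)) \<and>
    (\<forall>v\<in>pverts G. \<forall>v'\<in>pverts G. twins G v v' \<longrightarrow>
      \<not> ((\<exists>u\<in>pverts H. entirely (adj_dist G v v') H (fibre W v) u) \<and>
         (\<exists>u'\<in>pverts H. entirely (adj_dist G v v') H (fibre W v') u')))"
    (is "_ \<longleftrightarrow> ?fib \<and> ?tw")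
proof -
  let ?same = "\<lambda>x y. \<forall>w\<in>W. gdist P x w = gdist P y w"
  have sub: "fibre W v \<subseteq> pverts H" for v using W by (auto simp: fibre_def)
  define S where "S v u v' u' \<longleftrightarrow> ?same (v, u) (v', u')" for v u v' u'
  have res: "resolving_set P W \<longleftrightarrow> (\<forall>v\<in>pverts G. \<forall>u\<in>pverts H. \<forall>v'\<in>pverts G. \<forall>u'\<in>pverts H.
      S v u v' u' \<longrightarrow> v = v' \<and> u = u')"
    using W unfolding resolving_set_def inj_on_def metric_rep_eq_iff pverts_P S_def
    by (simp only: ball_simps split_paired_Ball_Sigma mem_Times_iff) simp
  \<comment> \<open>All of another copy is equidistant from the two vertices, so only the fibre over \<open>v\<close> matters.\<close>
  have same_fibre: "?same (v, u) (v, u') \<longleftrightarrow> adj_rep H (fibre W v) u = adj_rep H (fibre W v) u'"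
    if "v \<in> pverts G" "u \<in> pverts H" "u' \<in> pverts H" for v u u'
  proof -
    have "gdist P (v, u) (x, y) = gdist P (v, u') (x, y)"
      if "(x, y) \<in> W" "x \<noteq> v" for x y
      using that \<open>u \<in> _\<close> \<open>u' \<in> _\<close> W by (subst (1 2) gdist_distinct_fibres) auto
    moreover have "gdist P (v, u) (v, y) = gdist P (v, u') (v, y) \<longleftrightarrow> adj_dist H u y = adj_dist H u' y"
      if "(v, y) \<in> W" for y
      using that \<open>u \<in> _\<close> \<open>u' \<in> _\<close> \<open>v \<in> _\<close> W by (subst (1 2) gdist_same_fibre) auto
    ultimately show ?thesis
      by (force simp: adj_rep_eq_iff fibre_def)
  qed
  have diff_fibre: "?same (v, u) (v', u') \<longleftrightarrow> twins G v v' \<and>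
      entirely (adj_dist G v v') H (fibre W v) u \<and> entirely (adj_dist G v v') H (fibre W v') u'"
    if vs: "v \<in> pverts G" "v' \<in> pverts G" "v \<noteq> v'" and us: "u \<in> pverts H" "u' \<in> pverts H"
      and ne: "\<And>x. x \<in> pverts G \<Longrightarrow> fibre W x \<noteq> {}" for v v' u u'
  proof -
    have at_v: "gdist P (v, u) (v, y) = gdist P (v', u') (v, y) \<longleftrightarrow>
        ereal (adj_dist H u y) = gdist G v' v" if "(v, y) \<in> W" for y
    proof -
      have "gdist P (v, u) (v, y) = ereal (adj_dist H u y)"
        using that vs us W by (intro gdist_same_fibre) auto
      moreover have "gdist P (v', u') (v, y) = gdist G v' v"
        using that vs us W by (intro gdist_distinct_fibres) auto
      ultimately show ?thesis by simp
    qed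
    have at_v': "gdist P (v, u) (v', y) = gdist P (v', u') (v', y) \<longleftrightarrow>
        ereal (adj_dist H u' y) = gdist G v v'" if "(v', y) \<in> W" for y
    proof -
      have "gdist P (v', u') (v', y) = ereal (adj_dist H u' y)"
        using that vs us W by (intro gdist_same_fibre) auto
      moreover have "gdist P (v, u) (v', y) = gdist G v v'"
        using that vs us W by (intro gdist_distinct_fibres) auto
      ultimately show ?thesis by auto
    qed
    have other: "gdist P (v, u) (x, y) = gdist P (v', u') (x, y) \<longleftrightarrow> gdist G v x = gdist G v' x"
      if "(x, y) \<in> W" "x \<noteq> v" "x \<noteq> v'" for x y
      using that us W by (subst (1 2) gdist_distinct_fibres) auto
    have "?same (v, u) (v', u') \<longleftrightarrow>
        (\<forall>x\<in>pverts G - {v, v'}. \<forall>y\<in>fibre W x. gdist G v x = gdist G v' x) \<and>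
        (\<forall>y\<in>fibre W v. ereal (adj_dist H u y) = gdist G v' v) \<and>
        (\<forall>y\<in>fibre W v'. ereal (adj_dist H u' y) = gdist G v v')"
      (is "_ \<longleftrightarrow> ?R")
    proof
      assume "?same (v, u) (v', u')"
      then show ?R using at_v at_v' other by (auto simp: fibre_def)
    next
      assume R: ?R
      show "?same (v, u) (v', u')"
      proof
        fix w assume "w \<in> W"
        moreover obtain x y where "w = (x, y)" by (cases w)
        ultimately show "gdist P (v, u) w = gdist P (v', u') w"
          using R W at_v[of y] at_v'[of y] other[of x y] vs
          by (cases "x = v"; cases "x = v'") (auto simp: fibre_def)
      qed
    qed
    \<comment> \<open>An empty fibre over \<open>x\<close> would impose no condition at \<open>x\<close>; this is where \<open>ne\<close> enters.\<close>
    also have "(\<forall>x\<in>pverts G - {v, v'}. \<forall>y\<in>fibre W x. gdist G v x = gdist G v' x) \<longleftrightarrow> twins G v v'"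
      using ne twins_iff_gdist[OF G vs] by blast
    finally have *: "?same (v, u) (v', u') \<longleftrightarrow> twins G v v' \<and>
        (\<forall>y\<in>fibre W v. ereal (adj_dist H u y) = gdist G v' v) \<and>
        (\<forall>y\<in>fibre W v'. ereal (adj_dist H u' y) = gdist G v v')" .
    show ?thesis
    proof (cases "twins G v v'")
      case True
      then have "twins G v' v" by (rule twins_sym)
      then have "gdist G v' v = ereal (adj_dist G v v')" "gdist G v v' = ereal (adj_dist G v v')"
        using True twins_gdist[OF G connected_G card_G] vs pair_graph_sym[OF G, of v v']
        by (auto simp: adj_dist_def)
      then show ?thesis using * by (auto simp: entirely_iff)
    qed (use * in simp)
  qed
  have fib: "?fib \<longleftrightarrow> (\<forall>v\<in>pverts G. \<forall>u\<in>pverts H. \<forall>u'\<in>pverts H. S v u v u' \<longrightarrow> u = u')"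
    using sub same_fibre unfolding S_def adj_resolving_set_def inj_on_def by simp
  show ?thesis
  proof (cases ?fib)
    case True
    have ne: "fibre W x \<noteq> {}" if "x \<in> pverts G" for x
      using True that adj_resolving_set_nonempty card_H by blast
    have "S v u v' u' \<longleftrightarrow> twins G v v' \<and> entirely (adj_dist G v v') H (fibre W v) u \<and>
        entirely (adj_dist G v v') H (fibre W v') u'"
      if "v \<in> pverts G" "v' \<in> pverts G" "v \<noteq> v'" "u \<in> pverts H" "u' \<in> pverts H" for v u v' u'
      unfolding S_def using diff_fibre[OF that ne] by blast
    then have tw: "?tw \<longleftrightarrow> (\<forall>v\<in>pverts G. \<forall>v'\<in>pverts G. \<forall>u\<in>pverts H. \<forall>u'\<in>pverts H.
        v \<noteq> v' \<longrightarrow> \<not> S v u v' u')"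
      unfolding twins_def by meson
    show ?thesis
      unfolding fib tw res
    proof (intro iffI conjI ballI impI notI; (elim conjE)?)
      fix v u v' u'
      assume fibres: "\<forall>v\<in>pverts G. \<forall>u\<in>pverts H. \<forall>u'\<in>pverts H. S v u v u' \<longrightarrow> u = u'"
        and pairs: "\<forall>v\<in>pverts G. \<forall>v'\<in>pverts G. \<forall>u\<in>pverts H. \<forall>u'\<in>pverts H. v \<noteq> v' \<longrightarrow> \<not> S v u v' u'"
        and *: "v \<in> pverts G" "u \<in> pverts H" "v' \<in> pverts G" "u' \<in> pverts H" "S v u v' u'"
      show "v = v'" using pairs * by blast
      then show "u = u'" using fibres * by blast
    qed blast+
  next
    case False
    then show ?thesis unfolding fib res by blast
  qed
qed

section \<open>Counting\<close>

text \<open>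
  The vertices in classes of type (K) whose fibre is a basis inject into the set of these classes:
  two of them in a common class would be adjacent twins, each with an entirely \<open>1\<close> vertex. Every
  other vertex in a class of type (K) has a fibre larger than a basis.
\<close>

lemma card_resolving_set_ge:
  assumes one: "\<And>B. adj_basis H B \<Longrightarrow> \<exists>u\<in>pverts H. entirely 1 H B u"
    and res: "resolving_set P W"
  shows "card (pverts G) * adj_metric_dim H + num_K_verts G \<le> card W + iota_K G"
proof -
  let ?K = "\<Union>(K_classes G)"
  have W: "W \<subseteq> pverts G \<times> pverts H"
    using res by (simp add: resolving_set_def pverts_P)
  have fib: "adj_resolving_set H (fibre W v)" if "v \<in> pverts G" for v
    using res that unfolding resolving_set_iff_fibres[OF W] by blast
  \<comment> \<open>\<open>B\<close> collects the vertices in classes of type (K) that do not pay for an additional element.\<close>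
  define B where "B = {v \<in> ?K. adj_basis H (fibre W v)}"
  have K: "?K \<subseteq> pverts G" by (rule K_classes_subset)
  have finK: "finite ?K" using K finite_pverts(1) by (rule finite_subset)
  have "B \<subseteq> ?K" by (auto simp: B_def)
  then have "\<forall>v\<in>B. \<exists>C. C \<in> K_classes G \<and> v \<in> C" by blast
  then obtain c where c: "\<And>v. v \<in> B \<Longrightarrow> c v \<in> K_classes G \<and> v \<in> c v"
    by (metis bchoice)
  have "inj_on c B"
  proof (rule inj_onI, rule ccontr)
    fix v v' assume vs: "v \<in> B" "v' \<in> B" "c v = c v'" "v \<noteq> v'"
    then have "twins G v v'" "(v, v') \<in> parcs G"
      using K_class_adjacent_twins[OF G, of "c v" v v'] c by metis+
    moreover have "\<exists>u\<in>pverts H. entirely 1 H (fibre W v) u" "\<exists>u\<in>pverts H. entirely 1 H (fibre W v') u"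
      using vs one by (auto simp: B_def)
    moreover have "adj_dist G v v' = 1"
      using \<open>(v, v') \<in> parcs G\<close> vs(4) by (simp add: adj_dist_def)
    moreover have "v \<in> pverts G" "v' \<in> pverts G" using vs \<open>B \<subseteq> ?K\<close> K by blast+
    ultimately show False
      using res unfolding resolving_set_iff_fibres[OF W] by metis
  qed
  then have B_le: "card B \<le> iota_K G"
    unfolding iota_K_def using c finite_K_classes[OF finite_pverts(1)]
    by (intro card_inj_on_le[of c]) auto
  have "adj_metric_dim H + (if v \<in> ?K - B then 1 else 0) \<le> card (fibre W v)"
    if "v \<in> pverts G" for v
    using adj_metric_dim_le[OF fib[OF that]] fib[OF that]
    by (auto simp: B_def adj_basis_def)
  then have "(\<Sum>v\<in>pverts G. adj_metric_dim H + (if v \<in> ?K - B then 1 else 0)) \<le> card W"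
    unfolding card_eq_sum_card_fibres[OF finite_pverts W] by (rule sum_mono)
  moreover have "(\<Sum>v\<in>pverts G. if v \<in> ?K - B then 1 else 0) = card (?K - B)"
    using K finite_pverts(1) by (intro sum_indicator_card) auto
  moreover have "card (?K - B) + card B = card ?K"
    using \<open>B \<subseteq> ?K\<close> finK by (metis card_Diff_subset card_mono finite_subset le_add_diff_inverse2)
  ultimately show ?thesis
    using B_le by (simp add: sum.distrib num_K_verts_def)
qed

text \<open>
  Adjoining \<open>u\<close> to \<open>B\<close> destroys the only entirely \<open>1\<close> representation, so adjacent twins are
  separated as soon as one of them carries \<open>B \<union> {u}\<close>. Non-adjacent twins are separated by any
  superset of \<open>B\<close>, which has no entirely \<open>2\<close> vertex either.
\<close>

lemma resolving_set_from_basis: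
  assumes B: "adj_basis H B" and u: "u \<in> pverts H" "entirely 1 H B u"
    and two: "\<And>x. x \<in> pverts H \<Longrightarrow> \<not> entirely 2 H B x"
  obtains W where "resolving_set P W"
    "card W + iota_K G = card (pverts G) * adj_metric_dim H + num_K_verts G"
proof -
  let ?K = "\<Union>(K_classes G)"
  have Bres: "adj_resolving_set H B" and cardB: "card B = adj_metric_dim H"
    using B by (auto simp: adj_basis_def)
  then have Bsub: "B \<subseteq> pverts H" by (simp add: adj_resolving_set_def)
  have "u \<notin> B" using u(2) by (auto simp: entirely_iff adj_dist_def)
  have B'res: "adj_resolving_set H (insert u B)"
    using Bres u(1) Bsub by (intro adj_resolving_set_mono[OF Bres]) auto
  have B'one: "\<not> entirely 1 H (insert u B) x" if x: "x \<in> pverts H" for x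
  proof
    assume one: "entirely 1 H (insert u B) x"
    then have "adj_rep H B x = adj_rep H B u"
      using u(2) by (simp add: adj_rep_eq_iff entirely_iff)
    then have "x = u"
      using Bres x u(1) by (auto simp: adj_resolving_set_def dest: inj_onD)
    then show False using one by (simp add: entirely_iff adj_dist_def)
  qed
  have K: "?K \<subseteq> pverts G" by (rule K_classes_subset)
  have finK: "finite ?K" using K finite_pverts(1) by (rule finite_subset)
  have "\<forall>C\<in>K_classes G. \<exists>v. v \<in> C"
    by (metis (no_types, lifting) K_classes_def card.empty ex_in_conv mem_Collect_eq not_numeral_le_zero)
  then obtain r where r: "\<And>C. C \<in> K_classes G \<Longrightarrow> r C \<in> C"
    by (metis bchoice)
  define R where "R = r ` K_classes G"
  have "inj_on r (K_classes G)"
    using r K_classes_disjoint[OF G] by (metis inj_onI)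
  then have cardR: "card R = iota_K G" by (simp add: R_def iota_K_def card_image)
  have "R \<subseteq> ?K" using r by (auto simp: R_def)
  define f where "f v = (if v \<in> ?K - R then insert u B else B)" for v
  define W where "W = Sigma (pverts G) f"
  have W: "W \<subseteq> pverts G \<times> pverts H" using Bsub u(1) by (auto simp: W_def f_def split: if_splits)
  have fib: "fibre W v = f v" if "v \<in> pverts G" for v
    using that by (auto simp: fibre_def W_def)
  have no_two: "\<not> entirely 2 H (f v) x" if "x \<in> pverts H" for v x
    using two[OF that] by (auto simp: entirely_iff f_def)
  have no_one: "v \<notin> ?K - R" if "x \<in> pverts H" "entirely 1 H (f v) x" for v x
    using B'one[OF that(1)] that(2) unfolding f_def by (metis (full_types))
  have "resolving_set P W"
    unfolding resolving_set_iff_fibres[OF W]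
  proof (intro conjI ballI impI notI)
    show "adj_resolving_set H (fibre W v)" if "v \<in> pverts G" for v
      using that Bres B'res by (simp add: fib f_def)
  next
    fix v v'
    let ?e = "\<lambda>x. \<exists>y\<in>pverts H. entirely (adj_dist G v v') H (fibre W x) y"
    assume vs: "v \<in> pverts G" "v' \<in> pverts G" and tw: "twins G v v'" and "?e v \<and> ?e v'"
    then obtain y y' where y: "y \<in> pverts H" "entirely (adj_dist G v v') H (f v) y"
        "y' \<in> pverts H" "entirely (adj_dist G v v') H (f v') y'"
      using fib by auto
    have "v \<noteq> v'" using tw by (simp add: twins_def)
    show False
    proof (cases "(v, v') \<in> parcs G")
      case True
      then have "adj_dist G v v' = 1" using \<open>v \<noteq> v'\<close> by (simp add: adj_dist_def)
      then have "v \<notin> ?K - R" "v' \<notin> ?K - R" using y no_one by auto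
      moreover define C where "C = twin_rel G `` {v}"
      then have C: "C \<in> K_classes G" "v \<in> C" "v' \<in> C"
        using adjacent_twins_in_K_class[OF G vs tw True] vs tw by (auto simp: twin_rel_def)
      ultimately have "v \<in> R" "v' \<in> R" by blast+
      then have "v = r C" "v' = r C"
        using C r K_classes_disjoint[OF G] unfolding R_def by blast+
      then show False using \<open>v \<noteq> v'\<close> by simp
    next
      case False
      then have "adj_dist G v v' = 2" using \<open>v \<noteq> v'\<close> by (simp add: adj_dist_def)
      then show False using y no_two by simp
    qed
  qed
  moreover have "card W + iota_K G = card (pverts G) * adj_metric_dim H + num_K_verts G"
  proof -
    have "finite B" using Bsub finite_pverts(2) by (rule finite_subset)
    then have cf: "card (f v) = adj_metric_dim H + (if v \<in> ?K - R then 1 else 0)" for v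
      using \<open>u \<notin> B\<close> cardB by (simp add: f_def)
    have "card W = (\<Sum>v\<in>pverts G. card (f v))"
      using card_eq_sum_card_fibres[OF finite_pverts W] fib by simp
    also have "\<dots> = card (pverts G) * adj_metric_dim H + (\<Sum>v\<in>pverts G. if v \<in> ?K - R then 1 else 0)"
      unfolding cf by (simp add: sum.distrib)
    also have "(\<Sum>v\<in>pverts G. if v \<in> ?K - R then 1 else 0) = card (?K - R)"
      using K finite_pverts(1) by (intro sum_indicator_card) auto
    finally show ?thesis
      using \<open>R \<subseteq> ?K\<close> finK cardR card_Diff_subset[of R ?K] card_mono[of ?K R] finite_subset[of R ?K]
      by (simp add: num_K_verts_def)
  qed
  ultimately show thesis by (rule that)
qed

end

section \<open>Metric dimension of the lexicographic product\<close>

theorem theorem3: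
  fixes G :: "'a pair_pre_digraph" and H :: "'b pair_pre_digraph" and n :: nat
  assumes "pair_graph G" and "connected G" and "card (pverts G) = n" and "n \<ge> 2"
    and "pair_graph H" and "card (pverts H) \<ge> 2"
    and "\<forall>W. adj_basis H W \<longrightarrow> (\<exists>v\<in>pverts H. entirely 1 H W v)"
    and "\<exists>W. adj_basis H W \<and> \<not> (\<exists>v\<in>pverts H. entirely 2 H W v)"
  shows "int (metric_dim (lexicographic_product G H)) =
    int n * int (adj_metric_dim H) + int (num_K_verts G) - int (iota_K G)"
proof -
  interpret lexicographic_factors G H
    using assms by (intro lexicographic_factors.intro) simp_all
  obtain B where B: "adj_basis H B" "\<And>x. x \<in> pverts H \<Longrightarrow> \<not> entirely 2 H B x"
    using assms(8) by blast
  then obtain u where u: "u \<in> pverts H" "entirely 1 H B u"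
    using assms(7) by blast
  obtain W where W: "resolving_set P W"
      "card W + iota_K G = card (pverts G) * adj_metric_dim H + num_K_verts G"
    using resolving_set_from_basis[OF B(1) u B(2)] by blast
  have "card W \<le> card W'" if "resolving_set P W'" for W'
    using card_resolving_set_ge[OF _ that] assms(7) W(2) by fastforce
  then have "metric_dim P = card W"
    unfolding metric_dim_def using W(1) by (intro Least_equality) auto
  then show ?thesis
    using W(2) assms(3) by (simp flip: of_nat_mult of_nat_add)
qed

end
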